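(* Let $\alpha$ be a real number and $p/q\in\mathbb{Q}(\mathbf{H}_4)$ (in normalized form). (i) If $p/q$ is an $\mathbf{H}_4$-best approximation of $\alpha$, then $$\left|\alpha-\frac pq\right|<\frac1{q^2}.$$ (ii) If $$\left|\alpha-\frac pq\right|<\frac1{2q^2},$$ then $p/q$ is an $\mathbf{H}_4$-best approximation of $\alpha$. Moreover, the constant $1/2$ is optimal: it cannot be replaced by any larger number, i.e. for every $c>1/2$ there exist a real number $\alpha$ and $p/q\in\mathbb{Q}(\mathbf{H}_4)$ with $\left|\alpha-\frac pq\right|<\frac{c}{q^2}$ such that $p/q$ is not an $\mathbf{H}_4$-best approximation of $\alpha$.
   Context: The Hecke group $\mathbf{H}_4$ is the subgroup of $\mathrm{PSL}_2(\mathbb{R})$ generated by $\begin{pmatrix}1&\sqrt2\\0&1\end{pmatrix}$ and $\begin{pmatrix}0&-1\\1&0\end{pmatrix}$. The set $\mathbb{Q}(\mathbf{H}_4)\subset \mathbb{R}\cup\{\infty\}$ is the set of all $p/q$ such that $\begin{pmatrix} p & r \\ q & s \end{pmatrix}\in\mathbf{H}_4$ for some $r,s$; its finite elements form the set $\sqrt2\,\mathbb{Q}$. Writing $p/q\in\mathbb{Q}(\mathbf{H}_4)$ always means the normalized form: $(p,q)$ is the first column of a matrix in $\mathbf{H}_4$ with $q>0$. Explicitly, either $p=a$, $q=\sqrt2\,c$ with $a,c\in\mathbb{Z}$, $c>0$, $\gcd(a,2c)=1$, or $p=\sqrt2\,a$, $q=c$ with $a,c\in\mathbb{Z}$, $c>0$,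 $\gcd(2a,c)=1$. $p/q\in\mathbb{Q}(\mathbf{H}_4)$ is an $\mathbf{H}_4$-best approximation of a real number $\alpha$ if for any $r/s\in\mathbb{Q}(\mathbf{H}_4)$ with $r/s\ne p/q$ and $0<s\le q$ one has $|s\alpha-r|>|q\alpha-p|$. *)

theory Defs
  imports "HOL-Analysis.Analysis" "HOL-Algebra.Generated_Groups"
begin

definition SL2R :: "(real^2^2) monoid" where
  "SL2R = \<lparr>carrier = {A. det A = 1}, mult = (\<lambda>A B. A ** B), one = mat 1\<rparr>"

definition PSL2R :: "(real^2^2) set monoid" where
  "PSL2R = SL2R Mod {mat 1, - mat 1}"

definition PSL2R_class :: "real^2^2 \<Rightarrow> (real^2^2) set" where
  "PSL2R_class A = {mat 1, - mat 1} #>\<^bsub>SL2R\<^esub> A"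

definition hecke_T :: "real^2^2" where
  "hecke_T = vector [vector [1, sqrt 2], vector [0, 1]]"

definition hecke_S :: "real^2^2" where
  "hecke_S = vector [vector [0, -1], vector [1, 0]]"

definition H4 :: "(real^2^2) set set" where
  "H4 = generate PSL2R {PSL2R_class hecke_T, PSL2R_class hecke_S}"

text \<open>The pair \<open>(p, q)\<close> is the normalized form of a finite element \<open>p / q\<close> of
  \<open>\<rat>(H4)\<close>. The point \<open>\<infinity>\<close> of \<open>\<rat>(H4)\<close> corresponds to \<open>q = 0\<close> and has no
  normalized form.\<close>

definition H4_fraction :: "real \<Rightarrow> real \<Rightarrow> bool" where
  "H4_fraction p q \<longleftrightarrow> q > 0 \<and>
     (\<exists>A\<in>carrier SL2R. PSL2R_class A \<in> H4 \<and> A $ 1 $ 1 = p \<and> A $ 2 $ 1 = q)"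

definition H4_best_approx :: "real \<Rightarrow> real \<Rightarrow> real \<Rightarrow> bool" where
  "H4_best_approx \<alpha> p q \<longleftrightarrow> H4_fraction p q \<and>
     (\<forall>r s. H4_fraction r s \<and> r / s \<noteq> p / q \<and> s \<le> q \<longrightarrow>
        \<bar>s * \<alpha> - r\<bar> > \<bar>q * \<alpha> - p\<bar>)"

lemma group_SL2R: "group SL2R"
proof (rule groupI)
  fix A assume "A \<in> carrier SL2R"
  then have d: "det A = 1" by (simp add: SL2R_def)
  then obtain B where B: "B ** A = mat 1"
    using invertible_det_nz[of A] by (auto simp: invertible_def)
  then have "det B * det A = 1"
    by (metis det_I det_mul)
  with d B show "\<exists>B\<in>carrier SL2R. B \<otimes>\<^bsub>SL2R\<^esub> A = \<one>\<^bsub>SL2R\<^esub>"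
    by (auto simp: SL2R_def)
qed (auto simp: SL2R_def det_mul matrix_mul_assoc)

lemma mult_minus_mat_1 [simp]:
  "(- mat 1) ** A = - A" "A ** (- mat 1) = - A" for A :: "real^2^2"
  by (simp_all add: vec_eq_iff matrix_matrix_mult_def mat_def sum_2 forall_2)

lemma normal_pm_one_SL2R: "{mat 1, - mat 1} \<lhd> SL2R"
proof -
  interpret group SL2R by (rule group_SL2R)
  have car: "{mat 1, - mat 1} \<subseteq> carrier SL2R"
    by (auto simp: SL2R_def det_2 mat_def)
  have sub: "subgroup {mat 1, - mat 1} SL2R"
  proof (rule subgroupI)
    fix A assume A: "A \<in> {mat 1, - mat 1 :: real^2^2}"
    then have "A \<otimes>\<^bsub>SL2R\<^esub> A = \<one>\<^bsub>SL2R\<^esub>" by (auto simp: SL2R_def)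
    with A car have "inv\<^bsub>SL2R\<^esub> A = A" using inv_equality by blast
    with A show "inv\<^bsub>SL2R\<^esub> A \<in> {mat 1, - mat 1}" by simp
  qed (use car in \<open>auto simp: SL2R_def\<close>)
  show ?thesis
    by (rule normalI[OF sub]) (auto simp: r_coset_def l_coset_def SL2R_def)
qed

lemma group_PSL2R: "group PSL2R"
  unfolding PSL2R_def by (rule normal.factorgroup_is_group[OF normal_pm_one_SL2R])

lemma PSL2R_class_eq: "PSL2R_class A = {A, - A}"
  by (auto simp: PSL2R_class_def r_coset_def SL2R_def)

lemma PSL2R_class_in_carrier:
  "A \<in> carrier SL2R \<Longrightarrow> PSL2R_class A \<in> carrier PSL2R"
  by (auto simp: PSL2R_class_def PSL2R_def FactGroup_def RCOSETS_def)

lemma hecke_generators_in_SL2R: "hecke_T \<in> carrier SL2R" "hecke_S \<in> carrier SL2R"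
  by (simp_all add: SL2R_def hecke_T_def hecke_S_def det_2)

end

theory Submission
  imports Defs
begin

text \<open>Two distinct normalized fractions \<open>p / q\<close>, \<open>r / s\<close> satisfy \<open>\<bar>p * s - q * r\<bar> \<ge> 1\<close>, which
  gives the sufficient condition. For the necessary one, the column next to \<open>(p, q)\<close> in a matrix of
  the group can be moved by \<open>hecke_T\<close> and a sign to \<open>(r, s)\<close> with \<open>0 \<le> s \<le> q / sqrt 2\<close>. Comparing
  \<open>p / q\<close> with \<open>(r, s)\<close>, or with \<open>(p, q) + sqrt 2 (r, s)\<close> if \<open>s = 0\<close>, settles the case of \<open>\<alpha>\<close> on
  the side of \<open>r / s\<close>. On the other side one
  compares with \<open>sqrt 2 (p, q) - (r, s)\<close> (determinant 1) if \<open>s \<ge> (sqrt 2 - 1) q\<close> and with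
  \<open>(p, q) - sqrt 2 (r, s)\<close> (determinant \<open>sqrt 2\<close>) otherwise. Optimality is witnessed by
  \<open>\<alpha> = 1\<close>, which is equally well approximated by \<open>u / t\<close> and \<open>t / u\<close> when \<open>t\<^sup>2 - u\<^sup>2 = 1\<close>; large
  such pairs come from the powers of the matrix with rows \<open>(3, 2 sqrt 2)\<close>, \<open>(2 sqrt 2, 3)\<close>.\<close>

section \<open>The Hecke group as a group of matrices\<close>

definition mat2 :: "real \<Rightarrow> real \<Rightarrow> real \<Rightarrow> real \<Rightarrow> real^2^2" where
  "mat2 a b c d = vector [vector [a, b], vector [c, d]]"

lemma mat2_nth [simp]:
  "mat2 a b c d $ 1 $ 1 = a" "mat2 a b c d $ 1 $ 2 = b"
  "mat2 a b c d $ 2 $ 1 = c" "mat2 a b c d $ 2 $ 2 = d"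
  by (simp_all add: mat2_def)

lemma det_mat2 [simp]: "det (mat2 a b c d) = a * d - b * c"
  by (simp add: det_2)

lemma mat2_mult:
  "mat2 a b c d ** mat2 a' b' c' d' =
    mat2 (a * a' + b * c') (a * b' + b * d') (c * a' + d * c') (c * b' + d * d')"
  by (simp add: vec_eq_iff forall_2 matrix_matrix_mult_def sum_2)

lemma minus_mat2: "- mat2 a b c d = mat2 (- a) (- b) (- c) (- d)"
  by (simp add: vec_eq_iff forall_2)

lemma hecke_T_mat2: "hecke_T = mat2 1 (sqrt 2) 0 1"
  by (simp add: hecke_T_def mat2_def)

lemma hecke_S_mat2: "hecke_S = mat2 0 (-1) 1 0"
  by (simp add: hecke_S_def mat2_def)

lemma mat_1_mat2: "mat 1 = mat2 1 0 0 1"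
  by (simp add: vec_eq_iff forall_2 mat_def)

lemma carrier_SL2R_iff: "A \<in> carrier SL2R \<longleftrightarrow> det A = 1"
  by (simp add: SL2R_def)

lemma PSL2R_class_mult:
  assumes "det A = 1" "det B = 1"
  shows "PSL2R_class A \<otimes>\<^bsub>PSL2R\<^esub> PSL2R_class B = PSL2R_class (A ** B)"
proof -
  have "PSL2R_class A \<otimes>\<^bsub>PSL2R\<^esub> PSL2R_class B
      = {mat 1, - mat 1} #>\<^bsub>SL2R\<^esub> (A \<otimes>\<^bsub>SL2R\<^esub> B)"
    using normal.rcos_sum[OF normal_pm_one_SL2R, of A B] assms
    by (simp add: PSL2R_def FactGroup_def PSL2R_class_def carrier_SL2R_iff)
  then show ?thesis
    by (simp add: PSL2R_class_def) (simp add: SL2R_def)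
qed

lemma PSL2R_class_one: "\<one>\<^bsub>PSL2R\<^esub> = PSL2R_class (mat 1)"
  by (simp add: PSL2R_def FactGroup_def PSL2R_class_eq)

lemma PSL2R_class_minus: "PSL2R_class (- A) = PSL2R_class A"
  by (auto simp: PSL2R_class_eq)

lemma PSL2R_class_inv:
  assumes "det A = 1" "det B = 1" "B ** A = mat 1"
  shows "inv\<^bsub>PSL2R\<^esub> PSL2R_class A = PSL2R_class B"
  using assms
  by (intro group.inv_equality[OF group_PSL2R])
     (auto simp: PSL2R_class_mult PSL2R_class_one PSL2R_class_in_carrier carrier_SL2R_iff)

definition hecke_T_inv :: "real^2^2" where
  "hecke_T_inv = mat2 1 (- sqrt 2) 0 1"

lemma PSL2R_inv_generators:
  "inv\<^bsub>PSL2R\<^esub> PSL2R_class hecke_T = PSL2R_class hecke_T_inv"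
  "inv\<^bsub>PSL2R\<^esub> PSL2R_class hecke_S = PSL2R_class hecke_S"
proof -
  show "inv\<^bsub>PSL2R\<^esub> PSL2R_class hecke_T = PSL2R_class hecke_T_inv"
    by (rule PSL2R_class_inv)
       (simp_all add: hecke_T_mat2 hecke_T_inv_def mat2_mult mat_1_mat2)
  \<comment> \<open>The inverse matrix of \<open>hecke_S\<close> is its negative, which represents
    the same class.\<close>
  have "inv\<^bsub>PSL2R\<^esub> PSL2R_class hecke_S = PSL2R_class (- hecke_S)"
    by (rule PSL2R_class_inv)
       (simp_all add: hecke_S_mat2 minus_mat2 mat2_mult mat_1_mat2)
  then show "inv\<^bsub>PSL2R\<^esub> PSL2R_class hecke_S = PSL2R_class hecke_S"
    by (simp add: PSL2R_class_minus)
qed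

text \<open>The preimage of \<open>H4\<close> in SL(2,R): later computations run on matrices instead
  of cosets, and signs may be changed freely.\<close>

definition H4_matrix :: "real^2^2 \<Rightarrow> bool" where
  "H4_matrix A \<longleftrightarrow> det A = 1 \<and> PSL2R_class A \<in> H4"

lemma H4_matrix_mult: "H4_matrix A \<Longrightarrow> H4_matrix B \<Longrightarrow> H4_matrix (A ** B)"
  by (auto simp: H4_matrix_def det_mul H4_def simp flip: PSL2R_class_mult intro: generate.eng)

lemma H4_matrix_minus: "H4_matrix A \<Longrightarrow> H4_matrix (- A)"
  by (simp add: H4_matrix_def PSL2R_class_minus det_2)

lemma H4_matrix_generators:
  "H4_matrix hecke_T" "H4_matrix hecke_S" "H4_matrix hecke_T_inv" "H4_matrix (mat 1)"
proof -
  show "H4_matrix hecke_T" "H4_matrix hecke_S"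
    using hecke_generators_in_SL2R
    by (auto simp: H4_matrix_def H4_def carrier_SL2R_iff intro: generate.incl)
  have "inv\<^bsub>PSL2R\<^esub> PSL2R_class hecke_T \<in> H4"
    unfolding H4_def by (rule generate.inv) simp
  then show "H4_matrix hecke_T_inv"
    by (simp add: H4_matrix_def PSL2R_inv_generators) (simp add: hecke_T_inv_def)
  show "H4_matrix (mat 1)"
    by (auto simp: H4_matrix_def H4_def intro: generate.one simp flip: PSL2R_class_one)
qed

section \<open>Arithmetic shape of the elements\<close>

text \<open>The two alternatives act as a parity: \<open>hecke_T\<close> is of the first kind,
  \<open>hecke_S\<close> of the second.\<close>

definition H4_shape :: "real^2^2 \<Rightarrow> bool" where
  "H4_shape A \<longleftrightarrow> det A = 1 \<and>
     (\<exists>(a::int) (b::int) (c::int) (d::int). A = mat2 a (sqrt 2 * b) (sqrt 2 * c) d \<or>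
                       A = mat2 (sqrt 2 * a) b c (sqrt 2 * d))"

text \<open>The kinds add modulo 2, since \<open>sqrt 2 * sqrt 2\<close> is an integer: factors of
  equal kind give the first kind, factors of different kind the second.\<close>

lemma H4_shape_mult:
  assumes "H4_shape A" "H4_shape B"
  shows "H4_shape (A ** B)"
proof -
  obtain a b c d :: int where A: "A = mat2 a (sqrt 2 * b) (sqrt 2 * c) d \<or>
      A = mat2 (sqrt 2 * a) b c (sqrt 2 * d)"
    using assms by (auto simp: H4_shape_def)
  obtain a' b' c' d' :: int where B: "B = mat2 a' (sqrt 2 * b') (sqrt 2 * c') d' \<or>
      B = mat2 (sqrt 2 * a') b' c' (sqrt 2 * d')"
    using assms by (auto simp: H4_shape_def)
  have sq: "sqrt 2 * (x * (sqrt 2 * y)) = 2 * x * y" "sqrt 2 * (sqrt 2 * y) = 2 * y" for x y :: real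
    by (simp_all add: algebra_simps)
  have "\<exists>(a::int) (b::int) (c::int) (d::int). A ** B = mat2 a (sqrt 2 * b) (sqrt 2 * c) d \<or>
      A ** B = mat2 (sqrt 2 * a) b c (sqrt 2 * d)"
    using A B
  proof (elim disjE)
    assume "A = mat2 a (sqrt 2 * b) (sqrt 2 * c) d" "B = mat2 a' (sqrt 2 * b') (sqrt 2 * c') d'"
    then have "A ** B = mat2 (a * a' + 2 * b * c' :: int) (sqrt 2 * (a * b' + b * d' :: int))
        (sqrt 2 * (c * a' + d * c' :: int)) (2 * c * b' + d * d' :: int)"
      by (simp add: mat2_mult algebra_simps sq)
    then show ?thesis by blast
  next
    assume "A = mat2 (sqrt 2 * a) b c (sqrt 2 * d)" "B = mat2 (sqrt 2 * a') b' c' (sqrt 2 * d')"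
    then have "A ** B = mat2 (2 * a * a' + b * c' :: int) (sqrt 2 * (a * b' + b * d' :: int))
        (sqrt 2 * (c * a' + d * c' :: int)) (c * b' + 2 * d * d' :: int)"
      by (simp add: mat2_mult algebra_simps sq)
    then show ?thesis by blast
  next
    assume "A = mat2 a (sqrt 2 * b) (sqrt 2 * c) d" "B = mat2 (sqrt 2 * a') b' c' (sqrt 2 * d')"
    then have "A ** B = mat2 (sqrt 2 * (a * a' + b * c' :: int)) (a * b' + 2 * b * d' :: int)
        (2 * c * a' + d * c' :: int) (sqrt 2 * (c * b' + d * d' :: int))"
      by (simp add: mat2_mult algebra_simps sq)
    then show ?thesis by blast
  next
    assume "A = mat2 (sqrt 2 * a) b c (sqrt 2 * d)" "B = mat2 a' (sqrt 2 * b') (sqrt 2 * c') d'"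
    then have "A ** B = mat2 (sqrt 2 * (a * a' + b * c' :: int)) (2 * a * b' + b * d' :: int)
        (c * a' + 2 * d * c' :: int) (sqrt 2 * (c * b' + d * d' :: int))"
      by (simp add: mat2_mult algebra_simps sq)
    then show ?thesis by blast
  qed
  moreover have "det (A ** B) = 1"
    using assms by (simp add: H4_shape_def det_mul)
  ultimately show ?thesis unfolding H4_shape_def by blast
qed

lemma H4_shape_mat2:
  assumes "x * w - y * z = 1"
    "(\<exists>(a::int) (b::int) (c::int) (d::int). x = a \<and> y = sqrt 2 * b \<and> z = sqrt 2 * c \<and> w = d) \<or>
     (\<exists>(a::int) (b::int) (c::int) (d::int). x = sqrt 2 * a \<and> y = b \<and> z = c \<and> w = sqrt 2 * d)"
  shows "H4_shape (mat2 x y z w)"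
  using assms by (auto simp: H4_shape_def)

lemma H4_shape_generators:
  "H4_shape hecke_T" "H4_shape hecke_S" "H4_shape hecke_T_inv" "H4_shape (mat 1)"
proof -
  show "H4_shape hecke_T"
    unfolding hecke_T_mat2
    by (rule H4_shape_mat2, simp, rule disjI1, rule exI[of _ 1], rule exI[of _ 1],
        rule exI[of _ 0], rule exI[of _ 1]) simp
  show "H4_shape hecke_T_inv"
    unfolding hecke_T_inv_def
    by (rule H4_shape_mat2, simp, rule disjI1, rule exI[of _ 1], rule exI[of _ "-1"],
        rule exI[of _ 0], rule exI[of _ 1]) simp
  show "H4_shape hecke_S"
    unfolding hecke_S_mat2
    by (rule H4_shape_mat2, simp, rule disjI2, rule exI[of _ 0], rule exI[of _ "-1"],
        rule exI[of _ 1], rule exI[of _ 0]) simp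
  show "H4_shape (mat 1)"
    unfolding mat_1_mat2
    by (rule H4_shape_mat2, simp, rule disjI1, rule exI[of _ 1], rule exI[of _ 0],
        rule exI[of _ 0], rule exI[of _ 1]) simp
qed

lemma H4_shape_minus: "H4_shape A \<Longrightarrow> H4_shape (- A)"
proof -
  have "H4_shape (- mat 1)"
    unfolding mat_1_mat2 minus_mat2
    by (rule H4_shape_mat2, simp, rule disjI1, rule exI[of _ "-1"], rule exI[of _ 0],
        rule exI[of _ 0], rule exI[of _ "-1"]) simp
  then show "H4_shape A \<Longrightarrow> H4_shape (- A)"
    using H4_shape_mult[of "- mat 1" A] by simp
qed

text \<open>Induction over the generated subgroup sees only classes, so it yields some
  representative of the right shape. A class consists of a matrix and its negative, and the shape is
  invariant under sign.\<close>

lemma H4_has_shape: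
  assumes "H4_matrix A"
  shows "H4_shape A"
proof -
  have "\<exists>B. H4_shape B \<and> X = PSL2R_class B" if "X \<in> H4" for X
    using that unfolding H4_def
  proof (induction rule: generate.induct)
    case one
    then show ?case using H4_shape_generators PSL2R_class_one by blast
  next
    case (incl h)
    then show ?case using H4_shape_generators by blast
  next
    case (inv h)
    then show ?case using H4_shape_generators PSL2R_inv_generators by fastforce
  next
    case (eng h1 h2)
    then show ?case by (metis H4_shape_mult PSL2R_class_mult H4_shape_def)
  qed
  then obtain B where B: "H4_shape B" "PSL2R_class A = PSL2R_class B"
    using assms by (auto simp: H4_matrix_def)
  then have "A = B \<or> A = - B"
    by (auto simp: PSL2R_class_eq doubleton_eq_iff)
  then show ?thesis using B H4_shape_minus by blast
qed

section \<open>Normalized fractions and their cross determinants\<close>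

lemma H4_fraction_iff: "H4_fraction p q \<longleftrightarrow> q > 0 \<and> (\<exists>r s. H4_matrix (mat2 p r q s))"
proof
  assume "H4_fraction p q"
  then obtain A where A: "det A = 1" "PSL2R_class A \<in> H4" "A $ 1 $ 1 = p" "A $ 2 $ 1 = q" "q > 0"
    by (auto simp: H4_fraction_def carrier_SL2R_iff)
  have "A = mat2 p (A $ 1 $ 2) q (A $ 2 $ 2)"
    using A(3,4) by (simp add: vec_eq_iff forall_2)
  then have "H4_matrix (mat2 p (A $ 1 $ 2) q (A $ 2 $ 2))"
    using A(1,2) by (simp add: H4_matrix_def)
  then show "q > 0 \<and> (\<exists>r s. H4_matrix (mat2 p r q s))" using A(5) by blast
next
  assume "q > 0 \<and> (\<exists>r s. H4_matrix (mat2 p r q s))"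
  then obtain r s where "q > 0" "H4_matrix (mat2 p r q s)" by blast
  then show "H4_fraction p q"
    unfolding H4_fraction_def H4_matrix_def
    by (intro conjI bexI[of _ "mat2 p r q s"]) (simp_all only: carrier_SL2R_iff mat2_nth)
qed

text \<open>For the two shapes, determinant 1 reads \<open>a * d - 2 * b * c = 1\<close> or
  \<open>2 * a * d - b * c = 1\<close>, which forces the parity. Of the coprimality in the
  normalized form only this oddness is recorded.\<close>

lemma H4_fraction_cases:
  assumes "H4_fraction p q"
  obtains a c :: int where "p = a" "q = sqrt 2 * c" "odd a"
    | a c :: int where "p = sqrt 2 * a" "q = c" "odd c"
proof -
  obtain r s where A: "H4_shape (mat2 p r q s)"
    using assms H4_has_shape by (auto simp: H4_fraction_iff)
  then have det: "p * s - r * q = 1" by (simp add: H4_shape_def)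
  obtain a b c d :: int where "mat2 p r q s = mat2 a (sqrt 2 * b) (sqrt 2 * c) d \<or>
      mat2 p r q s = mat2 (sqrt 2 * a) b c (sqrt 2 * d)"
    using A by (auto simp: H4_shape_def)
  then consider
      "p = a" "r = sqrt 2 * b" "q = sqrt 2 * c" "s = d"
    | "p = sqrt 2 * a" "r = b" "q = c" "s = sqrt 2 * d"
    by (metis mat2_nth)
  then show thesis
  proof cases
    case 1
    then have "real_of_int (a * d - 2 * b * c) = real_of_int 1"
      using det by (simp add: algebra_simps)
    then have "a * d - 2 * b * c = 1" by (simp only: of_int_eq_iff)
    then have "odd a" by (metis dvd_diff dvd_mult2 dvd_triv_left mult.assoc odd_one)
    with 1 that show thesis by blast
  next
    case 2
    then have "real_of_int (2 * a * d - b * c) = real_of_int 1"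
      using det by (simp add: algebra_simps)
    then have "2 * a * d - b * c = 1" by (simp only: of_int_eq_iff)
    then have "odd c" by (metis dvd_diff dvd_mult dvd_triv_left mult.assoc odd_one)
    with 2 that show thesis by blast
  qed
qed

text \<open>For fractions of the same kind the cross determinant is \<open>sqrt 2\<close> times a
  nonzero integer; for different kinds it is an odd integer.\<close>

lemma H4_fraction_cross_ge_1:
  assumes "H4_fraction p q" "H4_fraction r s" "p * s \<noteq> q * r"
  shows "\<bar>p * s - q * r\<bar> \<ge> 1"
proof -
  have int_ge: "\<bar>real_of_int n\<bar> \<ge> 1" if "n \<noteq> 0" for n :: int
    using that by linarith
  have sqrt_ge: "\<bar>sqrt 2 * real_of_int n\<bar> \<ge> 1" if "sqrt 2 * real_of_int n \<noteq> 0" for n :: int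
    using mult_mono[of 1 "sqrt 2" 1 "\<bar>real_of_int n\<bar>"] int_ge[of n] that
    by (simp add: abs_mult)
  show ?thesis
    using assms(1)
  proof (cases rule: H4_fraction_cases)
    case (1 a c)
    note pq = this
    show ?thesis using assms(2)
    proof (cases rule: H4_fraction_cases)
      case (1 a' c')
      have "p * s - q * r = sqrt 2 * real_of_int (a * c' - c * a')"
        using pq 1 by (simp add: algebra_simps)
      then show ?thesis using sqrt_ge assms(3) by (metis eq_iff_diff_eq_0)
    next
      case (2 a' c')
      have "p * s - q * r = real_of_int (a * c' - 2 * c * a')"
        using pq 2 by (simp add: algebra_simps)
      moreover have "odd (a * c' - 2 * c * a')" using pq 2 by simp
      ultimately show ?thesis by (metis even_zero int_ge)
    qed
  next
    case (2 a c)
    note pq = this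
    show ?thesis using assms(2)
    proof (cases rule: H4_fraction_cases)
      case (1 a' c')
      have "p * s - q * r = real_of_int (2 * a * c' - c * a')"
        using pq 1 by (simp add: algebra_simps)
      moreover have "odd (2 * a * c' - c * a')" using pq 1 by simp
      ultimately show ?thesis by (metis even_zero int_ge)
    next
      case (2 a' c')
      have "p * s - q * r = sqrt 2 * real_of_int (a * c' - c * a')"
        using pq 2 by (simp add: algebra_simps)
      then show ?thesis using sqrt_ge assms(3) by (metis eq_iff_diff_eq_0)
    qed
  qed
qed

section \<open>Column operations\<close>

lemma H4_matrix_col_minus: "H4_matrix (mat2 p r q s) \<Longrightarrow> H4_matrix (mat2 (-p) (-r) (-q) (-s))"
  using H4_matrix_minus by (metis minus_mat2)

text \<open>Right multiplication by generators acts on columns: \<open>hecke_S\<close> exchanges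
  them up to a sign, while \<open>hecke_T\<close> and its inverse shift the second by
  \<open>sqrt 2\<close> times the first.\<close>

lemma H4_matrix_col_swap: "H4_matrix (mat2 p r q s) \<Longrightarrow> H4_matrix (mat2 r (-p) s (-q))"
  using H4_matrix_mult[OF _ H4_matrix_generators(2), of "mat2 p r q s"]
  by (simp add: hecke_S_mat2 mat2_mult)

lemma H4_matrix_col_add:
  "H4_matrix (mat2 p r q s) \<Longrightarrow> H4_matrix (mat2 p (r + sqrt 2 * p) q (s + sqrt 2 * q))"
  using H4_matrix_mult[OF _ H4_matrix_generators(1), of "mat2 p r q s"]
  by (simp add: hecke_T_mat2 mat2_mult algebra_simps)

lemma H4_matrix_col_diff:
  "H4_matrix (mat2 p r q s) \<Longrightarrow> H4_matrix (mat2 p (r - sqrt 2 * p) q (s - sqrt 2 * q))"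
  using H4_matrix_mult[OF _ H4_matrix_generators(3), of "mat2 p r q s"]
  by (simp add: hecke_T_inv_def mat2_mult algebra_simps)

lemma H4_matrix_col_add_int:
  assumes "H4_matrix (mat2 p r q s)"
  shows "H4_matrix (mat2 p (r + of_int k * (sqrt 2 * p)) q (s + of_int k * (sqrt 2 * q)))"
proof (induction k rule: int_induct[where k = 0])
  case base
  then show ?case using assms by simp
next
  case (step1 i)
  then show ?case using H4_matrix_col_add[OF step1(2)] by (simp add: algebra_simps)
next
  case (step2 i)
  then show ?case using H4_matrix_col_diff[OF step2(2)] by (simp add: algebra_simps)
qed

lemma H4_fraction_of_col1: "H4_matrix (mat2 p r q s) \<Longrightarrow> q > 0 \<Longrightarrow> H4_fraction p q"
  by (auto simp: H4_fraction_iff)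

lemma H4_fraction_of_col2: "H4_matrix (mat2 p r q s) \<Longrightarrow> s > 0 \<Longrightarrow> H4_fraction r s"
  using H4_matrix_col_swap H4_fraction_of_col1 by blast

lemma H4_fraction_of_col2_minus: "H4_matrix (mat2 p r q s) \<Longrightarrow> s < 0 \<Longrightarrow> H4_fraction (- r) (- s)"
  using H4_fraction_of_col2[OF H4_matrix_col_minus] by simp

text \<open>The shifts only change the second column, so the columns are first swapped; this makes
  the first one second with its sign reversed, and the sign is undone at the end.\<close>

lemma H4_fraction_col1_diff:
  assumes "H4_matrix (mat2 p r q s)" "q - sqrt 2 * s > 0"
  shows "H4_fraction (p - sqrt 2 * r) (q - sqrt 2 * s)"
  using H4_fraction_of_col2_minus[OF H4_matrix_col_add[OF H4_matrix_col_swap[OF assms(1)]]] assms(2)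
  by (simp add: algebra_simps)

lemma H4_fraction_col1_add:
  assumes "H4_matrix (mat2 p r q s)" "q + sqrt 2 * s > 0"
  shows "H4_fraction (p + sqrt 2 * r) (q + sqrt 2 * s)"
  using H4_fraction_of_col2_minus[OF H4_matrix_col_diff[OF H4_matrix_col_swap[OF assms(1)]]] assms(2)
  by (simp add: algebra_simps)

lemma H4_neighbour:
  assumes "H4_fraction p q"
  obtains r s \<epsilon> where "\<epsilon> = 1 \<or> \<epsilon> = -1" "H4_matrix (mat2 p (\<epsilon> * r) q (\<epsilon> * s))"
    "0 \<le> s" "sqrt 2 * s \<le> q"
proof -
  obtain r s where A: "H4_matrix (mat2 p r q s)" and q: "q > 0"
    using assms by (auto simp: H4_fraction_iff)
  \<comment> \<open>Reduces \<open>s\<close> modulo \<open>sqrt 2 * q\<close> to the interval from 0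
    to \<open>sqrt 2 * q\<close>. If the remainder exceeds half the period, which is
    \<open>q / sqrt 2\<close>, it is reflected, and \<epsilon> = -1 records the reflection.\<close>
  define k where "k = \<lfloor>s / (sqrt 2 * q)\<rfloor>"
  define r' where "r' = r - of_int k * (sqrt 2 * p)"
  define s' where "s' = s - of_int k * (sqrt 2 * q)"
  have A': "H4_matrix (mat2 p r' q s')"
    using H4_matrix_col_add_int[OF A, of "- k"] by (simp add: r'_def s'_def)
  have "of_int k \<le> s / (sqrt 2 * q)" "s / (sqrt 2 * q) < of_int k + 1"
    by (simp_all add: k_def)
  then have s': "0 \<le> s'" "s' < sqrt 2 * q"
    using q by (simp_all add: s'_def field_simps)
  show thesis
  proof (cases "sqrt 2 * s' \<le> q")
    case True
    then show thesis using that[of 1 r' s'] A' s' by simp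
  next
    case False
    have "sqrt 2 * (sqrt 2 * q - s') = 2 * q - sqrt 2 * s'" by (simp add: algebra_simps)
    then have "sqrt 2 * (sqrt 2 * q - s') \<le> q" using False by linarith
    then show thesis
      using that[of "-1" "sqrt 2 * p - r'" "sqrt 2 * q - s'"] H4_matrix_col_diff[OF A'] s'
      by simp
  qed
qed

section \<open>Best approximations\<close>

text \<open>The hypothesis \<open>side\<close> puts \<open>r / s\<close> on the same side of
  \<open>p / q\<close> as \<alpha> (or \<alpha> equals \<open>p / q\<close>). With
  \<open>x = q * \<alpha> - p\<close> and \<open>N = q * r - p * s\<close> one has
  \<open>q * (s * \<alpha> - r) = s * x - N\<close>, where the two terms do not have opposite
  signs.\<close>

lemma best_approx_same_side_bound:
  assumes best: "H4_best_approx \<alpha> p q" and rs: "H4_fraction r s" "s \<le> q"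
    and ne: "q * r - p * s \<noteq> 0" and side: "(q * r - p * s) * (q * \<alpha> - p) \<ge> 0"
  shows "\<bar>q * \<alpha> - p\<bar> * (q + s) < \<bar>q * r - p * s\<bar>"
proof -
  define N x where "N = q * r - p * s" and "x = q * \<alpha> - p"
  have pos: "q > 0" "s > 0"
    using best rs by (auto simp: H4_best_approx_def H4_fraction_def)
  have "r / s \<noteq> p / q"
    using ne pos by (simp add: field_simps)
  then have "\<bar>s * \<alpha> - r\<bar> > \<bar>x\<bar>"
    using best rs by (simp add: H4_best_approx_def x_def)
  then have "q * \<bar>x\<bar> < q * \<bar>s * \<alpha> - r\<bar>"
    using pos by simp
  also have "\<dots> = \<bar>s * x - N\<bar>"
    using pos by (simp add: x_def N_def algebra_simps abs_mult_pos' )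
  also have "\<dots> = \<bar>s * \<bar>x\<bar> - \<bar>N\<bar>\<bar>"
    using side pos unfolding N_def[symmetric] x_def[symmetric] zero_le_mult_iff
    by (auto simp: abs_if mult_less_0_iff)
  finally have *: "q * \<bar>x\<bar> < \<bar>s * \<bar>x\<bar> - \<bar>N\<bar>\<bar>" .
  have "s * \<bar>x\<bar> \<le> q * \<bar>x\<bar>"
    using rs by (simp add: mult_right_mono)
  \<comment> \<open>As \<open>s * \<bar>x\<bar>\<close> is at most \<open>q * \<bar>x\<bar>\<close>,
    the absolute value in \<open>*\<close> can only be
    \<open>\<bar>N\<bar> - s * \<bar>x\<bar>\<close>.\<close>
  with * have "q * \<bar>x\<bar> + s * \<bar>x\<bar> < \<bar>N\<bar>" by linarith
  then show ?thesis by (simp add: N_def x_def algebra_simps)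
qed

lemma best_approx_bound:
  assumes best: "H4_best_approx \<alpha> p q"
  shows "\<bar>q * \<alpha> - p\<bar> * q < 1"
proof -
  have pq: "H4_fraction p q" and q: "q > 0"
    using best by (auto simp: H4_best_approx_def H4_fraction_def)
  obtain r s \<epsilon> where \<epsilon>: "\<epsilon> = 1 \<or> \<epsilon> = -1" and A: "H4_matrix (mat2 p (\<epsilon> * r) q (\<epsilon> * s))"
    and s: "0 \<le> s" "sqrt 2 * s \<le> q"
    using H4_neighbour[OF pq] .
  define x where "x = q * \<alpha> - p"
  have one: "1 < sqrt 2" "sqrt 2 < 2" by (simp_all add: real_less_lsqrt)
  have N: "q * r - p * s = - \<epsilon>"
    using A \<epsilon> by (auto simp: H4_matrix_def algebra_simps)
  have sq: "s \<le> q"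
    using mult_right_mono[of 1 "sqrt 2" s] s one by linarith
  \<comment> \<open>By \<open>N\<close>, \<open>r / s\<close> lies on the side of
    \<open>p / q\<close> given by the sign of \<open>- \<epsilon>\<close>, so the sign of
    \<open>\<epsilon> * x\<close> tells whether \<alpha> is on that side.\<close>
  consider (same) "\<epsilon> * x \<le> 0" "s > 0" | (zero) "\<epsilon> * x \<le> 0" "s = 0"
    | (near) "\<epsilon> * x \<ge> 0" "s \<ge> (sqrt 2 - 1) * q" | (far) "\<epsilon> * x \<ge> 0" "s < (sqrt 2 - 1) * q"
    using s by linarith
  then show ?thesis
  proof cases
    case same
    have "H4_fraction r s"
      using A \<epsilon> same H4_fraction_of_col2[OF A] H4_fraction_of_col2_minus[OF A] by auto
    from best_approx_same_side_bound[OF best this sq] same \<epsilon> N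
    have "\<bar>x\<bar> * (q + s) < 1" by (auto simp: x_def)
    moreover have "\<bar>x\<bar> * q \<le> \<bar>x\<bar> * (q + s)" using s by (simp add: mult_left_mono)
    ultimately show ?thesis by (simp add: x_def)
  next
    case zero
    \<comment> \<open>The column \<open>(r, s)\<close> is the point at infinity here; adding it
      \<open>sqrt 2\<close> times gives a fraction with the same denominator \<open>q\<close> and
      determinant of size \<open>sqrt 2\<close>, so
      \<open>2 * q * \<bar>x\<bar> < sqrt 2\<close>.\<close>
    have f: "H4_fraction (p + sqrt 2 * r) q"
      using \<epsilon> H4_fraction_col1_add[OF A] H4_fraction_col1_diff[OF A] zero q by auto
    have "q * (p + sqrt 2 * r) - p * q = sqrt 2 * (q * r - p * s)"
      using zero by (simp add: algebra_simps)
    then have "q * (p + sqrt 2 * r) - p * q = - (sqrt 2 * \<epsilon>)" by (simp add: N)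
    moreover have "- (sqrt 2 * \<epsilon>) * x \<ge> 0"
      using zero(1) mult_nonneg_nonpos[of "sqrt 2" "\<epsilon> * x"] by (simp add: mult.assoc)
    ultimately
    have "\<bar>x\<bar> * (q + q) < sqrt 2"
      using best_approx_same_side_bound[OF best f] \<epsilon> unfolding x_def[symmetric] by auto
    then show ?thesis using one by (simp add: x_def algebra_simps)
  next
    case near
    \<comment> \<open>The threshold \<open>(sqrt 2 - 1) * q\<close> is exactly where the new
      denominator becomes admissible.\<close>
    have s': "sqrt 2 * q - s \<le> q" "sqrt 2 * q - s > 0"
      using near(2) sq mult_strict_right_mono[OF one(1) q] unfolding left_diff_distrib
      by linarith+
    have f: "H4_fraction (sqrt 2 * p - r) (sqrt 2 * q - s)"
      using \<epsilon> s' H4_fraction_of_col2_minus[OF H4_matrix_col_diff[OF A]]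
        H4_fraction_of_col2[OF H4_matrix_col_add[OF A]]
      by (auto simp: algebra_simps)
    have "q * (sqrt 2 * p - r) - p * (sqrt 2 * q - s) = \<epsilon>"
      using N by (simp add: algebra_simps)
    with best_approx_same_side_bound[OF best f s'(1)] near \<epsilon>
    have "\<bar>x\<bar> * (q + (sqrt 2 * q - s)) < 1" by (auto simp: x_def)
    moreover have "\<bar>x\<bar> * q \<le> \<bar>x\<bar> * (q + (sqrt 2 * q - s))"
      using s' by (intro mult_left_mono) auto
    ultimately show ?thesis by (simp add: x_def)
  next
    case far
    have "sqrt 2 * s < sqrt 2 * ((sqrt 2 - 1) * q)" using far by simp
    \<comment> \<open>Equivalently, the sum of the denominators \<open>q\<close> and
      \<open>q - sqrt 2 * s\<close> exceeds \<open>sqrt 2 * q\<close>, which compensates for the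
      determinant \<open>sqrt 2\<close>.\<close>
    then have u: "sqrt 2 * s < 2 * q - sqrt 2 * q" by (simp add: algebra_simps)
    then have s': "q - sqrt 2 * s > 0" "q - sqrt 2 * s \<le> q"
      using s mult_strict_right_mono[OF one(1) q] by auto
    have f: "H4_fraction (p - sqrt 2 * r) (q - sqrt 2 * s)"
      using \<epsilon> s' H4_fraction_col1_diff[OF A] H4_fraction_col1_add[OF A] by auto
    have "q * (p - sqrt 2 * r) - p * (q - sqrt 2 * s) = sqrt 2 * - (q * r - p * s)"
      by (simp add: algebra_simps)
    also have "\<dots> = sqrt 2 * \<epsilon>" by (simp add: N)
    finally have "q * (p - sqrt 2 * r) - p * (q - sqrt 2 * s) = sqrt 2 * \<epsilon>" .
    moreover have "sqrt 2 * \<epsilon> * x \<ge> 0"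
      using far(1) mult_nonneg_nonneg[of "sqrt 2" "\<epsilon> * x"] by (simp add: mult.assoc)
    ultimately have "\<bar>x\<bar> * (q + (q - sqrt 2 * s)) < sqrt 2"
      using best_approx_same_side_bound[OF best f s'(2)] \<epsilon> unfolding x_def[symmetric] by auto
    moreover have "\<bar>x\<bar> * (sqrt 2 * q) \<le> \<bar>x\<bar> * (q + (q - sqrt 2 * s))"
      using u by (intro mult_left_mono) auto
    ultimately have "\<bar>x\<bar> * (sqrt 2 * q) < sqrt 2" by linarith
    then have "sqrt 2 * (\<bar>x\<bar> * q) < sqrt 2 * 1" by (simp only: mult.left_commute mult_1_right)
    then have "\<bar>x\<bar> * q < 1" by (simp only: mult_less_cancel_left_pos real_sqrt_gt_0_iff zero_less_numeral)
    then show ?thesis by (simp add: x_def)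
  qed
qed

section \<open>The sufficient condition\<close>

lemma abs_diff_divide_less_iff:
  fixes \<alpha> p q c :: real
  assumes "q > 0"
  shows "\<bar>\<alpha> - p / q\<bar> < c / q\<^sup>2 \<longleftrightarrow> \<bar>q * \<alpha> - p\<bar> * q < c"
proof -
  have "\<bar>\<alpha> - p / q\<bar> = \<bar>(q * \<alpha> - p) / q\<bar>"
    using assms by (simp add: field_simps)
  also have "\<dots> = \<bar>q * \<alpha> - p\<bar> / q"
    using assms by simp
  finally show ?thesis
    using assms by (simp add: field_simps power2_eq_square)
qed

text \<open>The cross determinant is at least 1 and at most \<open>q * \<bar>s * \<alpha> - r\<bar>
  + q * \<bar>q * \<alpha> - p\<bar>\<close>. The second summand is below 1/2, so the first is above
  it.\<close>

lemma best_approx_if_close: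
  assumes pq: "H4_fraction p q" and close: "\<bar>q * \<alpha> - p\<bar> * q < 1 / 2"
  shows "H4_best_approx \<alpha> p q"
  unfolding H4_best_approx_def
proof (intro conjI allI impI)
  fix r s assume "H4_fraction r s \<and> r / s \<noteq> p / q \<and> s \<le> q"
  then have rs: "H4_fraction r s" and ne: "r / s \<noteq> p / q" and le: "s \<le> q" by auto
  have pos: "q > 0" "s > 0" using pq rs by (auto simp: H4_fraction_def)
  have "p * s \<noteq> q * r" using ne pos by (auto simp: field_simps)
  then have "1 \<le> \<bar>p * s - q * r\<bar>" using H4_fraction_cross_ge_1 pq rs by blast
  also have "p * s - q * r = q * (s * \<alpha> - r) - s * (q * \<alpha> - p)" by (simp add: algebra_simps)
  also have "\<bar>\<dots>\<bar> \<le> q * \<bar>s * \<alpha> - r\<bar> + s * \<bar>q * \<alpha> - p\<bar>"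
    using pos abs_triangle_ineq4[of "q * (s * \<alpha> - r)" "s * (q * \<alpha> - p)"] by (simp add: abs_mult)
  also have "s * \<bar>q * \<alpha> - p\<bar> \<le> q * \<bar>q * \<alpha> - p\<bar>" using le by (intro mult_right_mono) auto
  finally have "q * \<bar>q * \<alpha> - p\<bar> < q * \<bar>s * \<alpha> - r\<bar>" using close by (simp add: mult.commute)
  then show "\<bar>q * \<alpha> - p\<bar> < \<bar>s * \<alpha> - r\<bar>" using pos by simp
qed (rule pq)

section \<open>Optimality\<close>

text \<open>The step matrix is the square of \<open>hecke_T ** hecke_S ** hecke_T\<close>, which is
  \<open>mat2 (sqrt 2) 1 1 (sqrt 2)\<close>. The two minus signs in the proof cancel.\<close>

lemma H4_Pell_step:
  assumes "H4_matrix (mat2 t u u t)"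
  shows "H4_matrix (mat2 (3 * t + 2 * sqrt 2 * u) (2 * sqrt 2 * t + 3 * u)
    (2 * sqrt 2 * t + 3 * u) (3 * t + 2 * sqrt 2 * u))"
proof -
  have "H4_matrix (mat2 t u u t **
      (- (hecke_T ** (hecke_S ** (hecke_T ** (hecke_T ** (hecke_S ** hecke_T)))))))"
    by (intro H4_matrix_mult H4_matrix_minus H4_matrix_generators assms)
  moreover have "hecke_T ** (hecke_S ** (hecke_T ** (hecke_T ** (hecke_S ** hecke_T))))
      = mat2 3 (2 * sqrt 2) (2 * sqrt 2) 3"
    by (simp add: hecke_T_mat2 hecke_S_mat2 mat2_mult mult.left_commute[of "sqrt 2" 2 "sqrt 2"])
  ultimately have "H4_matrix (- (mat2 t u u t ** - mat2 3 (2 * sqrt 2) (2 * sqrt 2) 3))"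
    using H4_matrix_minus by metis
  then show ?thesis
    by (simp add: minus_mat2 mat2_mult algebra_simps)
qed

lemma H4_Pell_unbounded: "\<exists>t u. real n < t \<and> 0 < u \<and> H4_matrix (mat2 t u u t)"
proof (induction n)
  case 0
  \<comment> \<open>The identity has \<open>u = 0\<close>, so the induction starts one step later,
    at \<open>t = 3\<close>.\<close>
  have "H4_matrix (mat2 1 0 0 1)" using H4_matrix_generators(4) by (simp add: mat_1_mat2)
  from H4_Pell_step[OF this] have "H4_matrix (mat2 3 (2 * sqrt 2) (2 * sqrt 2) 3)" by simp
  then show ?case by (intro exI[of _ 3] exI[of _ "2 * sqrt 2"]) simp
next
  case (Suc n)
  then obtain t u where tu: "real n < t" "0 < u" "H4_matrix (mat2 t u u t)" by blast
  have "t * t - u * u = 1" using tu(3) by (simp add: H4_matrix_def)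
  moreover have "0 < u * u" using tu(2) by simp
  \<comment> \<open>Since \<open>1 < t\<close>, the new value \<open>3 * t + 2 * sqrt 2 * u\<close>
    exceeds \<open>t + 1\<close>, enough to pass to \<open>Suc n\<close>.\<close>
  ultimately have "1 < t * t" by linarith
  moreover have "0 \<le> t" using tu(1) of_nat_0_le_iff[of n] by linarith
  ultimately have "1 < t" using power_le_one[of t 2] by (auto simp: power2_eq_square not_le[symmetric])
  moreover have "0 < 2 * sqrt 2 * u" using tu(2) by simp
  ultimately have "real (Suc n) < 3 * t + 2 * sqrt 2 * u"
    using tu(1) unfolding of_nat_Suc by linarith
  moreover have "0 < 2 * sqrt 2 * t + 3 * u"
    using \<open>1 < t\<close> tu(2) by (intro add_pos_pos) auto
  ultimately show ?case using H4_Pell_step[OF tu(3)] by blast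
qed

lemma one_half_optimal:
  fixes c :: real
  assumes "c > 1 / 2"
  shows "\<exists>p q. H4_fraction p q \<and> \<bar>q * 1 - p\<bar> * q < c \<and> \<not> H4_best_approx 1 p q"
proof -
  \<comment> \<open>The goal is \<open>(t - u) * t < c\<close>, that is
    \<open>t < c * (t + u)\<close> because \<open>(t - u) * (t + u) = 1\<close>. As
    \<open>t - u < 1\<close>, it suffices that \<open>c < (2 * c - 1) * t\<close>, hence this
    bound.\<close>
  obtain n where n: "c / (2 * c - 1) < real n" using reals_Archimedean2 by blast
  obtain t u where tu: "real n < t" "0 < u" and A: "H4_matrix (mat2 t u u t)"
    using H4_Pell_unbounded by blast
  have t: "c < (2 * c - 1) * t"
    using n tu(1) assms mult_strict_left_mono[of "c / (2 * c - 1)" t "2 * c - 1"] by simp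
  then have "0 < t" using assms tu(1) of_nat_0_le_iff[of n] by linarith
  have det: "t\<^sup>2 - u\<^sup>2 = 1" using A by (simp add: H4_matrix_def power2_eq_square)
  then have prod: "(t - u) * (t + u) = 1" by (simp add: power2_eq_square algebra_simps)
  have "u < t" "1 < t"
  proof -
    have "u\<^sup>2 < t\<^sup>2" using det by linarith
    then show "u < t" using \<open>0 < t\<close> by (simp add: power_less_imp_less_base)
    have "1\<^sup>2 < t\<^sup>2" using det tu(2) zero_less_power[of u 2] unfolding one_power2 by linarith
    then show "1 < t" using \<open>0 < t\<close> power_less_imp_less_base[of 1 2 t] by simp
  qed
  have "t - u < 1"
  proof (rule ccontr)
    assume "\<not> t - u < 1"
    then have "t + u \<le> (t - u) * (t + u)" using \<open>0 < t\<close> tu(2) by (simp add: mult_right_mono)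
    then show False using prod \<open>1 < t\<close> tu(2) by linarith
  qed
  then have "c * (t - u) < c" using assms by simp
  also note t
  finally have "t < c * (t + u)" by (simp add: algebra_simps)
  then have "(t - u) * t < (t - u) * (c * (t + u))" using \<open>u < t\<close> by simp
  also have "\<dots> = c" using prod by (simp add: algebra_simps)
  finally have close: "\<bar>t * 1 - u\<bar> * t < c" using \<open>u < t\<close> by simp
  have "H4_fraction u t" "H4_fraction t u"
    using A H4_fraction_of_col1 H4_fraction_of_col2 \<open>0 < t\<close> tu(2) by blast+
  moreover have "t / u \<noteq> u / t"
    using det \<open>0 < t\<close> tu(2) by (auto simp: field_simps power2_eq_square)
  \<comment> \<open>For \<alpha> = 1 both fractions have error \<open>t - u\<close>, and
    \<open>t / u\<close> has the smaller denominator, so the strict inequality required of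
    \<open>u / t\<close> fails.\<close>
  ultimately have "\<not> H4_best_approx 1 u t"
    using \<open>u < t\<close> by (force simp: H4_best_approx_def)
  with close \<open>H4_fraction u t\<close> show ?thesis by blast
qed

theorem theorem1p3:
  "(\<forall>(\<alpha>::real) p q. H4_fraction p q \<and> H4_best_approx \<alpha> p q \<longrightarrow>
      \<bar>\<alpha> - p / q\<bar> < 1 / q\<^sup>2) \<and>
   (\<forall>(\<alpha>::real) p q. H4_fraction p q \<and> \<bar>\<alpha> - p / q\<bar> < 1 / (2 * q\<^sup>2) \<longrightarrow>
      H4_best_approx \<alpha> p q) \<and>
   (\<forall>c::real. c > 1 / 2 \<longrightarrow>
      (\<exists>(\<alpha>::real) p q. H4_fraction p q \<and> \<bar>\<alpha> - p / q\<bar> < c / q\<^sup>2 \<and>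
         \<not> H4_best_approx \<alpha> p q))"
proof (intro conjI allI impI)
  fix \<alpha> p q :: real
  assume "H4_fraction p q \<and> H4_best_approx \<alpha> p q"
  then show "\<bar>\<alpha> - p / q\<bar> < 1 / q\<^sup>2"
    using best_approx_bound abs_diff_divide_less_iff by (auto simp: H4_fraction_def)
next
  fix \<alpha> p q :: real
  assume *: "H4_fraction p q \<and> \<bar>\<alpha> - p / q\<bar> < 1 / (2 * q\<^sup>2)"
  then have "\<bar>\<alpha> - p / q\<bar> < (1 / 2) / q\<^sup>2" by simp
  then have "\<bar>q * \<alpha> - p\<bar> * q < 1 / 2"
    using * by (subst (asm) abs_diff_divide_less_iff) (auto simp: H4_fraction_def)
  then show "H4_best_approx \<alpha> p q" using * best_approx_if_close by blast
next
  fix c :: real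
  assume "c > 1 / 2"
  then obtain p q where "H4_fraction p q" "\<bar>q * 1 - p\<bar> * q < c" "\<not> H4_best_approx 1 p q"
    using one_half_optimal by blast
  moreover from this have "\<bar>1 - p / q\<bar> < c / q\<^sup>2"
    by (subst abs_diff_divide_less_iff) (auto simp: H4_fraction_def)
  ultimately show "\<exists>\<alpha> p q. H4_fraction p q \<and> \<bar>\<alpha> - p / q\<bar> < c / q\<^sup>2 \<and> \<not> H4_best_approx \<alpha> p q"
    by blast
qed

end
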